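(* Let $(P,\preceq)$ be a locally finite lattice and $f:P\to\mathbb{C}$. Let $X=\{x_1,\dots,x_n\}$ and $Y=\{y_1,\dots,y_n\}$ be subsets of $P$, indexed so that $x_i\preceq x_j\Rightarrow i\le j$ and $y_i\preceq y_j\Rightarrow i\le j$. Let $D=\{d_1,\dots,d_m\}$ be any finite subset of $P$ containing all $x_i\vee y_j$, indexed so that $d_i\preceq d_j\Rightarrow i\le j$. Let $X_i=X\setminus\{x_i\}$ and $Y_i=Y\setminus\{y_i\}$. If $[X,Y]_f$ is invertible, then its inverse is the $n\times n$ matrix $B=(b_{ij})$ with $$b_{ij}=\frac{(-1)^{i+j}}{\det[X,Y]_f}\sum_{1\le k_1<\cdots<k_{n-1}\le m}\det E(X_j)_{(k_1,\dots,k_{n-1})}\det E(Y_i)_{(k_1,\dots,k_{n-1})}\,\Psi_{D,f}(d_{k_1})\cdots\Psi_{D,f}(d_{k_{n-1}}).$$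
   Context: $[X,Y]_f$ is the $n\times n$ matrix with $(i,j)$ entry $f(x_i\vee y_j)$. $\Psi_{D,f}$ is defined on $D$ recursively by $\Psi_{D,f}(d_k)=f(d_k)-\sum_{d_v\in D,\ d_k\prec d_v}\Psi_{D,f}(d_v)$. For a subset $Z=\{z_1,\dots,z_r\}$ of $P$ (listed in its induced order), $E(Z)$ is the $r\times m$ matrix with $(i,j)$ entry $1$ if $z_i\preceq d_j$ and $0$ otherwise; thus $E(X_j)$ is $E(X)$ with row $j$ deleted and $E(Y_i)$ is $E(Y)$ with row $i$ deleted. For an $r\times m$ matrix $A$ and $1\le k_1<\dots<k_r\le m$, $A_{(k_1,\dots,k_r)}$ is the $r\times r$ submatrix of $A$ consisting of columns $k_1,\dots,k_r$. *)

theory Defs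
  imports Complex_Main "Jordan_Normal_Form.Determinant"
begin

text \<open>
  A finite subset \<open>{z\<^sub>1, \<dots>, z\<^sub>r}\<close> together with its indexing is represented by the list of its
  elements. Lists and matrices are indexed from 0; the parity of \<open>i + j\<close> does not depend on
  whether both indices start at 0 or at 1.
\<close>

definition order_indexed :: "'a::order list \<Rightarrow> bool" where
  "order_indexed zs \<longleftrightarrow> distinct zs \<and>
     (\<forall>i<length zs. \<forall>j<length zs. zs ! i \<le> zs ! j \<longrightarrow> i \<le> j)"

definition join_mat :: "('a::lattice \<Rightarrow> complex) \<Rightarrow> 'a list \<Rightarrow> 'a list \<Rightarrow> complex mat" where
  "join_mat f xs ys = mat (length xs) (length ys) (\<lambda>(i, j). f (sup (xs ! i) (ys ! j)))"

text \<open>The guard \<open>finite D\<close> only serves to make the recursion well-founded.\<close>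

function Psi :: "'a::order set \<Rightarrow> ('a \<Rightarrow> complex) \<Rightarrow> 'a \<Rightarrow> complex" where
  "Psi D f d = (if finite D then f d - (\<Sum>v\<in>{v \<in> D. d < v}. Psi D f v) else 0)"
  by pat_completeness auto
termination
proof (relation "measure (\<lambda>(D, f, d). card {v \<in> D. d < v})")
  fix D :: "'a set" and f :: "'a \<Rightarrow> complex" and d v
  assume fin: "finite D" and v: "v \<in> {v \<in> D. d < v}"
  have "{w \<in> D. v < w} \<subset> {w \<in> D. d < w}"
    using v by (auto intro: less_trans)
  then have "card {w \<in> D. v < w} < card {w \<in> D. d < w}"
    using fin by (intro psubset_card_mono) auto
  then show "((D, f, v), (D, f, d)) \<in> measure (\<lambda>(D, f, d). card {v \<in> D. d < v})"
    by simp
qed simp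

declare Psi.simps [simp del]

definition incidence_mat :: "'a::order list \<Rightarrow> 'a list \<Rightarrow> complex mat" where
  "incidence_mat ds zs =
     mat (length zs) (length ds) (\<lambda>(i, j). if zs ! i \<le> ds ! j then 1 else 0)"

definition select_cols :: "'b mat \<Rightarrow> nat list \<Rightarrow> 'b mat" where
  "select_cols A ks = mat (dim_row A) (length ks) (\<lambda>(i, j). A $$ (i, ks ! j))"

definition increasing_tuples :: "nat \<Rightarrow> nat \<Rightarrow> nat list set" where
  "increasing_tuples r m = {ks. length ks = r \<and> sorted_wrt (<) ks \<and> set ks \<subseteq> {..<m}}"

end

theory Submission
  imports Defs
begin

text \<open>
  Since \<open>D\<close> contains all joins, Moebius inversion gives \<open>f (x \<squnion> y)\<close> as the sum of \<open>\<Psi>\<^sub>D\<^sub>,\<^sub>f d\<close> over the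
  \<open>d \<in> D\<close> above both \<open>x\<close> and \<open>y\<close>, that is \<open>[X,Y]\<^sub>f = E(X) \<Lambda> E(Y)\<^sup>T\<close> with \<open>\<Lambda>\<close> the diagonal matrix of the
  \<open>\<Psi>\<close>-values. The minors of \<open>[X,Y]\<^sub>f\<close> are matrices of the same kind for the sets \<open>X\<^sub>j\<close> and \<open>Y\<^sub>i\<close>, so
  the Cauchy-Binet formula evaluates the cofactors, and Cramer's rule gives the inverse.
\<close>

section \<open>The Cauchy-Binet formula, plain and weighted\<close>

lemma increasing_tuples_distinct: "ks \<in> increasing_tuples r m \<Longrightarrow> distinct ks"
  by (auto simp: increasing_tuples_def strict_sorted_iff)

text \<open>An injection is determined by its image, listed increasingly as \<open>ks\<close>,
  together with the permutation \<open>p\<close> saying which position of \<open>ks\<close> each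
  argument goes to. This regroups the sum over injections in Cauchy-Binet. \<open>restrict\<close>
  makes the functions extensional, as \<open>PiE\<close> demands.\<close>

lemma bij_betw_injections:
  "bij_betw (\<lambda>(ks, p). restrict (\<lambda>i. ks ! p i) {0..<r})
     (increasing_tuples r m \<times> {p. p permutes {0..<r}})
     {g \<in> {0..<r} \<rightarrow>\<^sub>E {..<m}. inj_on g {0..<r}}"
  (is "bij_betw ?F (?K \<times> ?P) ?G")
proof (rule bij_betw_imageI)
  \<comment> \<open>A permutation does not change the image, so \<open>ks\<close> can be read off
    from the function alone.\<close>
  have img: "?F (ks, p) ` {0..<r} = set ks" if "ks \<in> ?K" "p \<in> ?P" for ks p
  proof -
    have len: "length ks = r" using that by (simp add: increasing_tuples_def)
    have "?F (ks, p) ` {0..<r} = (!) ks ` (p ` {0..<r})" by (simp add: image_image)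
    also have "p ` {0..<r} = {0..<r}" using that by (simp add: permutes_image)
    also have "(!) ks ` {0..<r} = set ks" using len nth_image[of r ks] by (simp add: atLeast0LessThan)
    finally show ?thesis .
  qed
  show "inj_on ?F (?K \<times> ?P)"
  proof (rule inj_onI, clarsimp)
    fix ks p ls q
    assume ks: "ks \<in> ?K" and ls: "ls \<in> ?K"
      and p: "p permutes {0..<r}" and q: "q permutes {0..<r}"
      and eq: "restrict (\<lambda>i. ks ! p i) {0..<r} = restrict (\<lambda>i. ls ! q i) {0..<r}"
    have "set ks = set ls" using img[OF ks, of p] img[OF ls, of q] p q eq by simp
    then have kl: "ks = ls"
      using ks ls by (auto simp: increasing_tuples_def intro: strict_sorted_equal)
    have "p i = q i" for i
    proof (cases "i < r")
      case True
      then have "ks ! p i = ks ! q i" using fun_cong[OF eq, of i] kl by simp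
      moreover have "p i < r" "q i < r"
        using True permutes_in_image[OF p, of i] permutes_in_image[OF q, of i] by auto
      ultimately show ?thesis
        using increasing_tuples_distinct[OF ks] ks
        by (simp add: nth_eq_iff_index_eq increasing_tuples_def)
    next
      case False
      then show ?thesis using p q by (simp add: permutes_not_in)
    qed
    then show "ks = ls \<and> p = q" using kl by auto
  qed
  show "?F ` (?K \<times> ?P) = ?G"
  proof (intro equalityI subsetI)
    fix g assume "g \<in> ?F ` (?K \<times> ?P)"
    then obtain ks p where ks: "ks \<in> ?K" and p: "p permutes {0..<r}"
      and g: "g = restrict (\<lambda>i. ks ! p i) {0..<r}" by auto
    have len: "length ks = r" using ks by (simp add: increasing_tuples_def)
    have pr: "p i < r" if "i < r" for i using that permutes_in_image[OF p, of i] by auto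
    have "inj_on g {0..<r}"
    proof (rule inj_onI)
      fix i j assume "i \<in> {0..<r}" "j \<in> {0..<r}" "g i = g j"
      then have "p i = p j"
        using increasing_tuples_distinct[OF ks] pr len by (simp add: g nth_eq_iff_index_eq)
      then show "i = j" using permutes_inj[OF p] by (simp add: inj_eq)
    qed
    moreover have "ks ! p i \<in> {..<m}" if "i \<in> {0..<r}" for i
      using that ks pr[of i] nth_mem[of "p i" ks] len
      by (simp add: increasing_tuples_def subset_iff)
    then have "g \<in> {0..<r} \<rightarrow>\<^sub>E {..<m}" by (simp add: g restrict_PiE_iff)
    ultimately show "g \<in> ?G" by simp
  next
    fix g assume "g \<in> ?G"
    then have g: "g \<in> {0..<r} \<rightarrow>\<^sub>E {..<m}" and inj: "inj_on g {0..<r}" by auto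
    define ks where "ks = sorted_list_of_set (g ` {0..<r})"
    have set_ks: "set ks = g ` {0..<r}" by (simp add: ks_def)
    have len: "length ks = r" using inj by (simp add: ks_def card_image)
    have "sorted_wrt (<) ks" unfolding ks_def by (rule strict_sorted_list_of_set)
    then have ks: "ks \<in> ?K" using g set_ks len by (auto simp: increasing_tuples_def)
    have bij_ks: "bij_betw ((!) ks) {0..<r} (g ` {0..<r})"
      using bij_betw_nth[OF increasing_tuples_distinct[OF ks], of "{0..<r}"] len set_ks
      by (simp add: atLeast0LessThan)
    \<comment> \<open>\<open>q i\<close> is the position of \<open>g i\<close> in \<open>ks\<close>;
      \<open>p\<close> continues it by the identity, since \<open>permutes\<close> requires fixed
      points outside \<open>{0..<r}\<close>.\<close>
    define q where "q = inv_into {0..<r} ((!) ks) \<circ> g"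
    define p where "p i = (if i \<in> {0..<r} then q i else i)" for i
    have "bij_betw q {0..<r} {0..<r}"
      unfolding q_def
      using inj by (intro bij_betw_trans[OF inj_on_imp_bij_betw bij_betw_inv_into[OF bij_ks]])
    then have "bij_betw p {0..<r} {0..<r}"
      by (rule bij_betw_cong[THEN iffD1, rotated]) (simp add: p_def)
    then have p: "p permutes {0..<r}" by (rule bij_imp_permutes) (simp add: p_def)
    have "ks ! p i = g i" if "i \<in> {0..<r}" for i
      using that bij_betw_inv_into_right[OF bij_ks, of "g i"] by (simp add: p_def q_def)
    then have "g = ?F (ks, p)" using g by (auto simp: fun_eq_iff PiE_def extensional_def)
    then show "g \<in> ?F ` (?K \<times> ?P)" using ks p by blast
  qed
qed

text \<open>Expanding by multilinearity gives a sum over all ways \<open>g\<close> to choose a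
  column for each row. Choices with a repetition vanish, and the rest are grouped by the set of
  chosen columns.\<close>

theorem Cauchy_Binet:
  fixes A B :: "'b::comm_ring_1 mat"
  assumes A: "A \<in> carrier_mat r m" and B: "B \<in> carrier_mat r m"
  shows "det (A * transpose_mat B) =
    (\<Sum>ks \<in> increasing_tuples r m. det (select_cols A ks) * det (select_cols B ks))"
proof -
  let ?U = "{0..<r}"
  let ?K = "increasing_tuples r m" and ?P = "{p. p permutes ?U}"
  \<comment> \<open>\<open>h g\<close> is the total contribution of the choice \<open>g\<close>: the
    signed sum over permutations of the \<open>B\<close>-factors is a determinant whose row
    \<open>i\<close> is column \<open>g i\<close> of \<open>B\<close>.\<close>
  define h where "h g = (\<Prod>i\<in>?U. A $$ (i, g i)) * det (mat r r (\<lambda>(i, j). B $$ (j, g i)))" for g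
  have perm_lt: "p i < r" if "p \<in> ?P" "i < r" for p i
    using that permutes_in_image[of p ?U i] by auto
  have "det (A * transpose_mat B) =
      (\<Sum>p\<in>?P. signof p * (\<Prod>i\<in>?U. \<Sum>k<m. A $$ (i, k) * B $$ (p i, k)))"
  proof (subst det_def'[where n = r])
    show "A * transpose_mat B \<in> carrier_mat r r" using A B by simp
    have "(A * transpose_mat B) $$ (i, p i) = (\<Sum>k<m. A $$ (i, k) * B $$ (p i, k))"
      if "p \<in> ?P" "i < r" for p i
      using that perm_lt[OF that] A B
      by (simp add: scalar_prod_def atLeast0LessThan)
    then show "(\<Sum>p\<in>?P. signof p * (\<Prod>i\<in>?U. (A * transpose_mat B) $$ (i, p i))) =
      (\<Sum>p\<in>?P. signof p * (\<Prod>i\<in>?U. \<Sum>k<m. A $$ (i, k) * B $$ (p i, k)))"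
      by (intro sum.cong refl arg_cong2[where f = "(*)"] prod.cong) auto
  qed
  also have "\<dots> = (\<Sum>p\<in>?P. \<Sum>g \<in> ?U \<rightarrow>\<^sub>E {..<m}.
      signof p * ((\<Prod>i\<in>?U. A $$ (i, g i)) * (\<Prod>i\<in>?U. B $$ (p i, g i))))"
    by (simp add: prod_sum_PiE sum_distrib_left prod.distrib)
  also have "\<dots> = (\<Sum>g \<in> ?U \<rightarrow>\<^sub>E {..<m}. h g)"
  proof (subst sum.swap, rule sum.cong[OF refl])
    fix g
    have "det (mat r r (\<lambda>(i, j). B $$ (j, g i))) =
        (\<Sum>p\<in>?P. signof p * (\<Prod>i\<in>?U. B $$ (p i, g i)))"
      by (subst det_def'[where n = r]) (auto intro!: sum.cong prod.cong simp: perm_lt)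
    then show "(\<Sum>p\<in>?P. signof p * ((\<Prod>i\<in>?U. A $$ (i, g i)) * (\<Prod>i\<in>?U. B $$ (p i, g i)))) = h g"
      by (simp add: h_def sum_distrib_left mult_ac)
  qed
  \<comment> \<open>If \<open>g i = g j\<close> with \<open>i \<noteq> j\<close>, the determinant in
    \<open>h g\<close> has two equal rows.\<close>
  also have "\<dots> = (\<Sum>g \<in> {g \<in> ?U \<rightarrow>\<^sub>E {..<m}. inj_on g ?U}. h g)"
  proof (rule sum.mono_neutral_right)
    show "finite (?U \<rightarrow>\<^sub>E {..<m})" by (simp add: finite_PiE)
    show "\<forall>g \<in> (?U \<rightarrow>\<^sub>E {..<m}) - {g \<in> ?U \<rightarrow>\<^sub>E {..<m}. inj_on g ?U}. h g = 0"
    proof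
      fix g assume "g \<in> (?U \<rightarrow>\<^sub>E {..<m}) - {g \<in> ?U \<rightarrow>\<^sub>E {..<m}. inj_on g ?U}"
      then obtain i j where "i < r" "j < r" "i \<noteq> j" "g i = g j" by (auto simp: inj_on_def)
      then have "det (mat r r (\<lambda>(i, j). B $$ (j, g i))) = 0"
        by (intro det_identical_rows[of _ r i j]) (auto intro!: eq_vecI)
      then show "h g = 0" by (simp add: h_def)
    qed
  qed auto
  also have "\<dots> = (\<Sum>(ks, p) \<in> ?K \<times> ?P. h (restrict (\<lambda>i. ks ! p i) ?U))"
    by (subst sum.reindex_bij_betw[OF bij_betw_injections, symmetric])
      (simp add: case_prod_unfold)
  also have "\<dots> = (\<Sum>ks\<in>?K. \<Sum>p\<in>?P. h (restrict (\<lambda>i. ks ! p i) ?U))"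
    by (simp add: sum.cartesian_product)
  also have "\<dots> = (\<Sum>ks\<in>?K. det (select_cols A ks) * det (select_cols B ks))"
  proof (rule sum.cong[OF refl])
    fix ks assume "ks \<in> ?K"
    then have len: "length ks = r" by (simp add: increasing_tuples_def)
    have cA: "select_cols A ks \<in> carrier_mat r r" and cB: "select_cols B ks \<in> carrier_mat r r"
      using A B len by (auto simp: select_cols_def)
    \<comment> \<open>The determinant in \<open>h\<close> is that of the transpose of
      \<open>select_cols B ks\<close> with rows permuted by \<open>p\<close>, which contributes the
      sign. That sign and the \<open>A\<close>-factors form one Leibniz term of
      \<open>det (select_cols A ks)\<close>.\<close>
    have hp: "h (restrict (\<lambda>i. ks ! p i) ?U) =
        signof p * (\<Prod>i\<in>?U. select_cols A ks $$ (i, p i)) * det (select_cols B ks)"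
      if p: "p \<in> ?P" for p
    proof -
      have "mat r r (\<lambda>(i, j). B $$ (j, restrict (\<lambda>i. ks ! p i) ?U i)) =
          mat r r (\<lambda>(i, j). transpose_mat (select_cols B ks) $$ (p i, j))"
        using B len perm_lt[OF p] by (intro eq_matI) (auto simp: select_cols_def)
      moreover have "det (mat r r (\<lambda>(i, j). transpose_mat (select_cols B ks) $$ (p i, j))) =
          signof p * det (select_cols B ks)"
        using det_permute_rows[of "transpose_mat (select_cols B ks)" r p] p cB
        by (simp add: det_transpose)
      moreover have "(\<Prod>i\<in>?U. A $$ (i, restrict (\<lambda>i. ks ! p i) ?U i)) =
          (\<Prod>i\<in>?U. select_cols A ks $$ (i, p i))"
        using A len perm_lt[OF p] by (intro prod.cong) (auto simp: select_cols_def)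
      ultimately show ?thesis by (simp add: h_def mult_ac)
    qed
    show "(\<Sum>p\<in>?P. h (restrict (\<lambda>i. ks ! p i) ?U)) = det (select_cols A ks) * det (select_cols B ks)"
      using hp by (simp add: det_def'[OF cA] sum_distrib_right)
  qed
  finally show ?thesis .
qed

text \<open>Each Leibniz term meets every column exactly once, so it picks up every weight
  \<open>w j\<close> exactly once.\<close>

lemma det_scale_cols:
  assumes A: "A \<in> carrier_mat n n"
  shows "det (mat n n (\<lambda>(i, j). A $$ (i, j) * w j)) = det A * (\<Prod>j<n. w j)"
proof -
  have "(\<Prod>i=0..<n. mat n n (\<lambda>(i, j). A $$ (i, j) * w j) $$ (i, p i)) =
      (\<Prod>i=0..<n. A $$ (i, p i)) * (\<Prod>j<n. w j)" if p: "p permutes {0..<n}" for p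
  proof -
    have "(\<Prod>i=0..<n. mat n n (\<lambda>(i, j). A $$ (i, j) * w j) $$ (i, p i)) =
        (\<Prod>i=0..<n. A $$ (i, p i) * w (p i))"
      using permutes_in_image[OF p] by (intro prod.cong) auto
    also have "\<dots> = (\<Prod>i=0..<n. A $$ (i, p i)) * (\<Prod>j=0..<n. w j)"
      using prod.permute[OF p, of w] by (simp add: prod.distrib comp_def)
    finally show ?thesis by (simp add: atLeast0LessThan)
  qed
  then have "det (mat n n (\<lambda>(i, j). A $$ (i, j) * w j)) =
      (\<Sum>p | p permutes {0..<n}. signof p * ((\<Prod>i=0..<n. A $$ (i, p i)) * (\<Prod>j<n. w j)))"
    by (subst det_def'[where n = n]) (auto intro!: sum.cong)
  also have "\<dots> = det A * (\<Prod>j<n. w j)"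
    unfolding det_def'[OF A] sum_distrib_right by (simp only: mult.assoc)
  finally show ?thesis .
qed

corollary Cauchy_Binet_weighted:
  fixes A B :: "'b::comm_ring_1 mat"
  assumes A: "A \<in> carrier_mat r m" and B: "B \<in> carrier_mat r m"
  shows "det (mat r r (\<lambda>(i, j). \<Sum>k<m. A $$ (i, k) * B $$ (j, k) * w k)) =
    (\<Sum>ks \<in> increasing_tuples r m.
       det (select_cols A ks) * det (select_cols B ks) * (\<Prod>k\<leftarrow>ks. w k))"
proof -
  \<comment> \<open>The weights are absorbed into the columns of the second factor and reappear in
    each of its minors as a product over the selected columns.\<close>
  define C where "C = mat r m (\<lambda>(i, k). B $$ (i, k) * w k)"
  have C: "C \<in> carrier_mat r m" by (simp add: C_def)
  have "mat r r (\<lambda>(i, j). \<Sum>k<m. A $$ (i, k) * B $$ (j, k) * w k) = A * transpose_mat C"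
    using A B by (intro eq_matI) (auto simp: C_def scalar_prod_def atLeast0LessThan mult_ac)
  moreover have "det (select_cols C ks) = det (select_cols B ks) * (\<Prod>k\<leftarrow>ks. w k)"
    if "ks \<in> increasing_tuples r m" for ks
  proof -
    have len: "length ks = r" and "set ks \<subseteq> {..<m}"
      using that by (auto simp: increasing_tuples_def)
    then have lt: "ks ! i < m" if "i < r" for i
      using that nth_mem[of i ks] by (simp add: subset_iff)
    have "select_cols C ks = mat r r (\<lambda>(i, j). select_cols B ks $$ (i, j) * w (ks ! j))"
      using B len lt by (intro eq_matI) (auto simp: C_def select_cols_def)
    moreover have "select_cols B ks \<in> carrier_mat r r"
      using B len by (auto simp: select_cols_def)
    moreover have "(\<Prod>k\<leftarrow>ks. w k) = (\<Prod>j<r. w (ks ! j))"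
      by (simp add: prod.list_conv_set_nth len atLeast0LessThan)
    ultimately show ?thesis by (simp add: det_scale_cols)
  qed
  ultimately show ?thesis
    using Cauchy_Binet[OF A C] by (simp add: mult.assoc)
qed

section \<open>Moebius inversion and the factorization of the join matrix\<close>

lemma sum_Psi_above:
  fixes d :: "'a::order"
  assumes "finite D" "d \<in> D"
  shows "(\<Sum>v\<in>{v \<in> D. d \<le> v}. Psi D f v) = f d"
proof -
  \<comment> \<open>Once the summand at \<open>d\<close> is split off, the remaining sum is the one
    subtracted in the recursion for \<open>Psi\<close>, and the two cancel.\<close>
  have "{v \<in> D. d \<le> v} = insert d {v \<in> D. d < v}" using assms by (auto simp: le_less)
  then show ?thesis using assms by (simp add: Psi.simps[of D f d])
qed

text \<open>An element lies above \<open>sup x y\<close> iff it lies above both \<open>x\<close> and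
  \<open>y\<close>, so the indicator in the inverted sum for \<open>f (sup x y)\<close> is a product
  of two incidence entries.\<close>

lemma join_mat_factorization:
  fixes f :: "'a::lattice \<Rightarrow> complex"
  assumes ds: "distinct ds"
    and sup: "\<And>x y. x \<in> set xs \<Longrightarrow> y \<in> set ys \<Longrightarrow> sup x y \<in> set ds"
  shows "join_mat f xs ys = mat (length xs) (length ys) (\<lambda>(i, j).
    \<Sum>k<length ds. incidence_mat ds xs $$ (i, k) * incidence_mat ds ys $$ (j, k) *
      Psi (set ds) f (ds ! k))"
  (is "_ = ?R")
proof (rule eq_matI)
  fix i j
  assume "i < dim_row ?R" and "j < dim_col ?R"
  then have i: "i < length xs" and j: "j < length ys" by simp_all
  let ?s = "sup (xs ! i) (ys ! j)"
  have "f ?s = (\<Sum>v\<in>{v \<in> set ds. ?s \<le> v}. Psi (set ds) f v)"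
    using sum_Psi_above[of "set ds" ?s f] sup i j by simp
  also have "\<dots> = (\<Sum>v\<in>set ds. if ?s \<le> v then Psi (set ds) f v else 0)"
    by (simp add: sum.inter_filter)
  also have "\<dots> = (\<Sum>k<length ds. if ?s \<le> ds ! k then Psi (set ds) f (ds ! k) else 0)"
    by (rule sum.reindex_bij_betw[OF bij_betw_nth[OF ds refl refl], symmetric])
  also have "\<dots> = (\<Sum>k<length ds. incidence_mat ds xs $$ (i, k) * incidence_mat ds ys $$ (j, k) *
      Psi (set ds) f (ds ! k))"
    using i j by (intro sum.cong) (auto simp: incidence_mat_def)
  finally show "join_mat f xs ys $$ (i, j) = ?R $$ (i, j)"
    using i j by (simp add: join_mat_def)
qed (simp_all add: join_mat_def)

section \<open>Minors of the join matrix\<close>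

lemma removeAll_nth_distinct:
  assumes "distinct xs" "j < length xs"
  shows "removeAll (xs ! j) xs = take j xs @ drop (Suc j) xs"
proof -
  have "xs = take j xs @ xs ! j # drop (Suc j) xs" using assms by (simp add: id_take_nth_drop)
  \<comment> \<open>Distinctness keeps the removed value out of both pieces, so deletion by value is
    deletion by position.\<close>
  moreover from this assms(1) have "xs ! j \<notin> set (take j xs)" "xs ! j \<notin> set (drop (Suc j) xs)"
    by (metis distinct.simps(2) distinct_append disjoint_iff list.set_intros(1))+
  ultimately show ?thesis by (metis removeAll.simps(2) removeAll_append removeAll_id)
qed

lemma join_mat_removeAll:
  assumes "distinct xs" "i < length xs" "distinct ys" "j < length ys"
  shows "join_mat f (removeAll (xs ! i) xs) (removeAll (ys ! j) ys) =
    mat_delete (join_mat f xs ys) i j"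
  using assms
  by (intro eq_matI)
    (auto simp: join_mat_def mat_delete_def removeAll_nth_distinct nth_append min_def)

text \<open>The two lists are arbitrary up to equal length and joins in \<open>ds\<close>, so that
  the formula also covers minors, where each list has lost an element.\<close>

lemma det_join_mat:
  fixes f :: "'a::lattice \<Rightarrow> complex"
  assumes "distinct ds" "length xs = r" "length ys = r"
    and "\<And>x y. x \<in> set xs \<Longrightarrow> y \<in> set ys \<Longrightarrow> sup x y \<in> set ds"
  shows "det (join_mat f xs ys) =
    (\<Sum>ks \<in> increasing_tuples r (length ds).
       det (select_cols (incidence_mat ds xs) ks) * det (select_cols (incidence_mat ds ys) ks) *
       (\<Prod>k\<leftarrow>ks. Psi (set ds) f (ds ! k)))"
  using assms join_mat_factorization[OF assms(1,4), where f = f]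
    Cauchy_Binet_weighted[of "incidence_mat ds xs" r "length ds" "incidence_mat ds ys"
      "\<lambda>k. Psi (set ds) f (ds ! k)"]
  by (simp add: incidence_mat_def)

section \<open>The inverse from the adjugate\<close>

lemma invertible_mat_det_nonzero:
  fixes A :: "'b::idom mat"
  assumes "invertible_mat A"
  shows "det A \<noteq> 0"
proof -
  from assms obtain C where sq: "dim_row A = dim_col A"
    and AC: "A * C = 1\<^sub>m (dim_row A)" and CA: "C * A = 1\<^sub>m (dim_row C)"
    by (auto simp: invertible_mat_def inverts_mat_def)
  have A: "A \<in> carrier_mat (dim_row A) (dim_row A)" using sq by (metis carrier_matI)
  \<comment> \<open>Comparing column counts in the two inverse equations fixes both dimensions of
    \<open>C\<close>, as needed for multiplicativity of \<open>det\<close>.\<close>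
  have C: "C \<in> carrier_mat (dim_row A) (dim_row A)"
    using arg_cong[OF AC, of dim_col] arg_cong[OF CA, of dim_col] sq by (intro carrier_matI) simp_all
  have "det A * det C = 1" using det_mult[OF A C] unfolding AC by simp
  then show ?thesis by auto
qed

theorem theorem5p1:
  fixes f :: "'a::lattice \<Rightarrow> complex"
    and xs ys ds :: "'a list"
    and n m :: nat
    and B :: "complex mat"
  assumes locally_finite: "\<And>a b :: 'a. finite {a..b}"
    and "length xs = n" and "order_indexed xs"
    and "length ys = n" and "order_indexed ys"
    and "length ds = m" and "order_indexed ds"
    and "\<And>x y. x \<in> set xs \<Longrightarrow> y \<in> set ys \<Longrightarrow> sup x y \<in> set ds"
    and "invertible_mat (join_mat f xs ys)"
    and "B = mat n n (\<lambda>(i, j).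
          (- 1) ^ (i + j) / det (join_mat f xs ys) *
          (\<Sum>ks \<in> increasing_tuples (n - 1) m.
             det (select_cols (incidence_mat ds (removeAll (xs ! j) xs)) ks) *
             det (select_cols (incidence_mat ds (removeAll (ys ! i) ys)) ks) *
             (\<Prod>k\<leftarrow>ks. Psi (set ds) f (ds ! k))))"
  shows "inverts_mat (join_mat f xs ys) B \<and> inverts_mat B (join_mat f xs ys)"
proof -
  let ?A = "join_mat f xs ys"
  have dxs: "distinct xs" and dys: "distinct ys" and dds: "distinct ds"
    using assms by (simp_all add: order_indexed_def)
  have A: "?A \<in> carrier_mat n n" using assms by (simp add: join_mat_def)
  have nz: "det ?A \<noteq> 0" using assms by (simp add: invertible_mat_det_nonzero)
  \<comment> \<open>The adjugate transposes: entry \<open>(i, j)\<close> uses the minor without row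
    \<open>j\<close> and column \<open>i\<close>, hence without \<open>xs ! j\<close> and
    \<open>ys ! i\<close>. Here \<open>i < n\<close> gives \<open>n \<ge> 1\<close>, so
    \<open>n - 1\<close> is not truncated.\<close>
  have entry: "B $$ (i, j) = 1 / det ?A * cofactor ?A j i" if ij: "i < n" "j < n" for i j
  proof -
    have "length (removeAll (xs ! j) xs) = n - 1" "length (removeAll (ys ! i) ys) = n - 1"
      using ij dxs dys assms by (simp_all add: removeAll_nth_distinct)
    then have "det (mat_delete ?A j i) =
        (\<Sum>ks \<in> increasing_tuples (n - 1) (length ds).
           det (select_cols (incidence_mat ds (removeAll (xs ! j) xs)) ks) *
           det (select_cols (incidence_mat ds (removeAll (ys ! i) ys)) ks) *
           (\<Prod>k\<leftarrow>ks. Psi (set ds) f (ds ! k)))"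
      using ij dxs dys dds assms
      by (subst join_mat_removeAll[symmetric]) (auto intro!: det_join_mat)
    then show ?thesis using ij assms by (simp add: cofactor_def add.commute)
  qed
  have B: "B = (1 / det ?A) \<cdot>\<^sub>m adj_mat ?A"
  proof (rule eq_matI)
    show "B $$ (i, j) = ((1 / det ?A) \<cdot>\<^sub>m adj_mat ?A) $$ (i, j)"
      if "i < dim_row ((1 / det ?A) \<cdot>\<^sub>m adj_mat ?A)" "j < dim_col ((1 / det ?A) \<cdot>\<^sub>m adj_mat ?A)"
      for i j
      using that A entry[of i j] by (auto simp: adj_mat_def)
  qed (use A assms in \<open>auto simp: adj_mat_def\<close>)
  note adj = adj_mat[OF A]
  \<comment> \<open>Both products of a matrix with its adjugate equal \<open>det ?A\<close> times
    the identity, and the scalar cancels because \<open>det ?A\<close> is nonzero.\<close>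
  have "?A * B = 1\<^sub>m n" "B * ?A = 1\<^sub>m n"
    unfolding B mult_smult_distrib[OF A adj(1)] mult_smult_assoc_mat[OF adj(1) A] adj(2,3)
    using nz by (auto intro!: eq_matI)
  moreover have "dim_row ?A = n" "dim_row B = n" using A assms by auto
  ultimately show ?thesis by (simp add: inverts_mat_def)
qed

end
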